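(* Let $K, L, N$ be positive integers with $L\le K$. For $s\in\{1,\ldots,K\}$ put $p=p(s)=\min(s+L-1,K)$, and for real $M$ define $$R_{\text{cut-set}}(M)=\max_{s\in\{1,2,\ldots,\min(K,N)\}}\left(s-\frac{p}{\lfloor N/s\rfloor}M\right)$$ and $$R_{\text{new}}(M)=\max_{\substack{s\in\{1,2,\ldots,K\}\\ l\in\{1,2,\ldots,\lceil N/s\rceil\}}}\ \frac{1}{l}\left\{N-\left(1-\frac{p}{K}\right)(N-ls)^+-(N-lK)^+-pM\right\}.$$ Then for all $M\in\left[0,\frac{N}{L}\right]$ we have $R_{\text{new}}(M)\ge R_{\text{cut-set}}(M)$.
   Context: For real $x$, $(x)^+=\max(0,x)$. *)

theory Defs
  imports Complex_Main
begin

definition pos_part :: "real \<Rightarrow> real" where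
  "pos_part x = max 0 x"

(* The truncated subtraction is exact here: s + L >= 1 since s is positive. *)
definition p_val :: "nat \<Rightarrow> nat \<Rightarrow> nat \<Rightarrow> nat" where
  "p_val K L s = min (s + L - 1) K"

(* For K, N > 0 both maxima below range over finite nonempty sets, and all the
   denominators are positive (in particular floor (N / s) >= 1 because s <= N). *)
definition R_cut_set :: "nat \<Rightarrow> nat \<Rightarrow> nat \<Rightarrow> real \<Rightarrow> real" where
  "R_cut_set K L N M =
     Max ((\<lambda>s. real s - real (p_val K L s) / real_of_int \<lfloor>real N / real s\<rfloor> * M) ` {1..min K N})"

definition R_new :: "nat \<Rightarrow> nat \<Rightarrow> nat \<Rightarrow> real \<Rightarrow> real" where
  "R_new K L N M =
     Max ((\<lambda>(s, l). 1 / real l *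
            (real N - (1 - real (p_val K L s) / real K) * pos_part (real N - real l * real s)
             - pos_part (real N - real l * real K) - real (p_val K L s) * M))
          ` (SIGMA s:{1..K}. {1..nat \<lceil>real N / real s\<rceil>}))"

end

theory Submission
  imports Defs
begin

text \<open>
  The cut-set bound for \<open>s\<close> is dominated by the new bound for the same \<open>s\<close> and
  \<open>l = N div s\<close>. With \<open>r = N mod s\<close>, the difference of the two values is
  \<open>(p * r / K - (N - l * K)\<^sup>+) / l\<close>, and \<open>N - l * K = r - l * (K - s)\<close>
  is at most \<open>s * r / K \<le> p * r / K\<close> because \<open>r \<le> K \<le> l * K\<close>.
\<close>

lemma le_p_val:
  assumes "0 < L" and "s \<le> K"
  shows "s \<le> p_val K L s"
  using assms by (auto simp: p_val_def)

text \<open>Purely real form of the termwise comparison: \<open>l\<close> and \<open>r\<close> stand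
  for quotient and remainder, and only \<open>s \<le> p\<close> is kept of \<open>p_val\<close>, so
  no floor or \<open>min\<close> enters the algebra.\<close>

lemma cut_set_term_le_new_term:
  fixes s l r p K N M :: real
  assumes N: "N = l * s + r" and "0 \<le> r" "r \<le> s" "s \<le> K" "0 < K" "s \<le> p" "1 \<le> l"
  shows "s - p / l * M \<le>
    1 / l * (N - (1 - p / K) * pos_part (N - l * s) - pos_part (N - l * K) - p * M)"
proof -
  \<comment> \<open>With \<open>N = l * s + r\<close>, this is a rearrangement of
    \<open>(N - l * K) * K \<le> s * r\<close>.\<close>
  have "r * (K - s) \<le> l * K * (K - s)"
  proof (rule mult_right_mono)
    have "1 * K \<le> l * K"
      using assms by (intro mult_right_mono) auto
    then show "r \<le> l * K"
      using assms by linarith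
  qed (use assms in simp)
  then have "(N - l * K) * K \<le> s * r"
    using N by (simp add: algebra_simps)
  also have "s * r \<le> p * r"
    using assms by (intro mult_right_mono) auto
  finally have "N - l * K \<le> p * r / K"
    using \<open>0 < K\<close> by (simp add: pos_le_divide_eq)
  \<comment> \<open>The other argument of the maximum is 0, and \<open>p * r / K\<close> is
    nonnegative since \<open>p \<ge> s \<ge> r \<ge> 0\<close>.\<close>
  then have excess: "pos_part (N - l * K) \<le> p * r / K"
    using assms by (simp add: pos_part_def)
  have "s - p / l * M = 1 / l * (l * s - p * M)"
    using \<open>1 \<le> l\<close> by (simp add: field_simps)
  \<comment> \<open>Here \<open>r - (1 - p / K) * r\<close> equals \<open>p * r / K\<close>, which
    absorbs the excess.\<close>
  also have "\<dots> \<le> 1 / l * (l * s + r - (1 - p / K) * r - pos_part (N - l * K) - p * M)"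
    using excess \<open>1 \<le> l\<close> by (intro mult_left_mono) (auto simp: left_diff_distrib)
  also have "r = pos_part (N - l * s)"
    using N \<open>0 \<le> r\<close> by (simp add: pos_part_def)
  finally show ?thesis
    using N \<open>0 \<le> r\<close> by (simp add: pos_part_def)
qed

theorem lemma4:
  fixes K L N :: nat and M :: real
  assumes "0 < K" and "0 < L" and "0 < N" and "L \<le> K"
    and "M \<in> {0..real N / real L}"
  shows "R_new K L N M \<ge> R_cut_set K L N M"
proof -
  define f where "f = (\<lambda>(s, l). 1 / real l *
      (real N - (1 - real (p_val K L s) / real K) * pos_part (real N - real l * real s)
       - pos_part (real N - real l * real K) - real (p_val K L s) * M))"
  define A where "A = (SIGMA s:{1..K}. {1..nat \<lceil>real N / real s\<rceil>})"
  have new: "R_new K L N M = Max (f ` A)"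
    by (simp add: R_new_def f_def A_def)
  have "finite A"
    by (simp add: A_def)
  have "real s - real (p_val K L s) / real_of_int \<lfloor>real N / real s\<rfloor> * M \<le> R_new K L N M"
    if s: "s \<in> {1..min K N}" for s
  proof -
    define l where "l = N div s"
    have floor: "\<lfloor>real N / real s\<rfloor> = int l"
      by (simp add: l_def floor_divide_of_nat_eq)
    have "1 \<le> l"
      using s by (simp add: l_def div_greater_zero_iff Suc_le_eq)
    \<comment> \<open>The floor \<open>l\<close> must lie in the index range of
      \<open>R_new\<close>, which ends at the ceiling.\<close>
    have "int l \<le> \<lceil>real N / real s\<rceil>"
      using floor floor_le_ceiling[of "real N / real s"] by linarith
    then have "l \<le> nat \<lceil>real N / real s\<rceil>"
      by linarith
    then have "(s, l) \<in> A"
      using s \<open>1 \<le> l\<close> by (simp add: A_def)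
    have "N = l * s + N mod s"
      by (simp add: l_def)
    then have "real N = real l * real s + real (N mod s)"
      by (metis of_nat_add of_nat_mult)
    then have "real s - real (p_val K L s) / real l * M \<le> f (s, l)"
      unfolding f_def case_prod_conv
      by (rule cut_set_term_le_new_term)
        (use s \<open>1 \<le> l\<close> assms le_p_val[of L s K] in \<open>auto intro: less_imp_le\<close>)
    also have "\<dots> \<le> R_new K L N M"
      unfolding new using \<open>finite A\<close> \<open>(s, l) \<in> A\<close> by (intro Max_ge) auto
    finally show ?thesis
      by (simp add: floor)
  qed
  moreover have "{1..min K N} \<noteq> {}"
    using assms by auto
  ultimately show ?thesis
    unfolding R_cut_set_def by (subst Max_le_iff) auto
qed

end
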